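(* Let $[a_1,a_2,\dots,a_n]$ be a positive continued fraction with $a_1>1$, and let $\mathcal G[a_1,\dots,a_n]=(G_1,\dots,G_{\ell_n-1})$ be the corresponding snake graph, the tile $G_j$ being labeled $\tau_j$. Suppose that the minimal perfect matching of $\mathcal G[a_1,\dots,a_n]$ contains the west edge of the first tile. Then the $F$-polynomial associated to $\mathcal G[a_1,\dots,a_n]$ is $$F(\mathcal G[a_1,\dots,a_n])=\begin{cases}C_n^{-1}\,\mathcal N[\mathcal L_1,\dots,\mathcal L_n] & \text{if } n \text{ is odd},\\ \mathcal N[\mathcal L_1,\dots,\mathcal L_n] & \text{if } n\text{ is even},\end{cases}$$ where $\mathcal L_i=\varphi_iC_i$ and $$C_i=\begin{cases}\prod_{j=\ell_1}^{\ell_i-1}y_{\tau_j}^{-1} & i \text{ odd},\\[2pt] \prod_{j=\ell_1}^{\ell_{i-1}}y_{\tau_j} & i\text{ even},\end{cases}\qquad \varphi_i=\begin{cases}\sum_{k=\ell_{i-1}+1}^{\ell_i}\ \prod_{j=k}^{\ell_i-1}y_{\tau_j} & i\text{ odd},\\[2pt] \sum_{k=\ell_{i-1}}^{\ell_i-1}\ \prod_{j=\ell_{i-1}+1}^{k}y_{\tau_j} & i\text{ even}.\end{cases}$$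
   Context: A continued fraction $[a_1,\dots,a_n]=a_1+1/(a_2+1/(\cdots+1/a_n))$ is positive if all $a_i$ are positive integers. Put $\ell_i=a_1+\cdots+a_i$, $\ell_0=0$. Empty products are $1$. A snake graph is a connected graph $(G_1,\dots,G_d)$ of unit square tiles with sides parallel to the axes, where $G_{k+1}$ is glued to $G_k$ along an edge $e_k$ that is either the north edge of $G_k$ (= south edge of $G_{k+1}$) or the east edge of $G_k$ (= west edge of $G_{k+1}$). Let $e_0$ be the south edge of $G_1$ and $e_d$ the north or east edge of $G_d$. A sign function assigns $\pm$ to edges so that in each tile the north and west edges have the same sign, the south and east edges have the same sign, and the north and south edges have opposite signs. $\mathcal G[a_1,\dots,a_n]$ is the snake graph with $d=\ell_n-1$ tiles for which (for a suitable choice of $e_d$) the sign sequence of $(e_0,e_1,\dots,e_d)$ is $a_1$ signs $-$, then $a_2$ signs $+$, then $a_3$ signs $-$, and so on, alternating. A snake graph has exactly two perfect matchings consisting of boundary edges only; one is designated the minimal matching $P_-$ and the other the maximal matching $P_+$. For a perfect matching $P$, the symmetric difference $P\ominus P_-$ is the boundary of a union of tiles $G_j$, $j\in J$, and its height monomial is $y(P)=\prod_{j\in J}y_{\tau_j}$, where the $y_{\tau_j}$ are indeterminates. The $F$-polynomial is $F(\mathcal G)=\sum_P y(P)$, summed over all perfect matchings of $\mathcal G$. $\mathcal N[\mathcal L_1]=\mathcal L_1$, $\mathcal N[\mathcal L_1,\mathcal L_2]=\mathcal L_1\mathcal L_2+1$, and $\mathcal N[\mathcal L_1,\dots,\mathcal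 L_n]=\mathcal L_n\mathcal N[\mathcal L_1,\dots,\mathcal L_{n-1}]+\mathcal N[\mathcal L_1,\dots,\mathcal L_{n-2}]$ for $n\ge3$. *)

theory Defs
  imports Main "HOL-Library.Poly_Mapping"
begin

section \<open>Laurent polynomials\<close>

text \<open>
  The group ring of the free abelian group on \<open>'l\<close> over the integers is the ring of integer
  Laurent polynomials in the indeterminates \<open>yvar l\<close>, one for each label \<open>l\<close>.
\<close>

type_synonym 'l laurent = "('l \<Rightarrow>\<^sub>0 int) \<Rightarrow>\<^sub>0 int"

definition yvar :: "'l \<Rightarrow> 'l laurent" where
  "yvar l = Poly_Mapping.single (Poly_Mapping.single l 1) 1"

text \<open>The inverse of a unit of a commutative ring (unspecified for non-units).\<close>

definition unit_inv :: "'a::comm_ring_1 \<Rightarrow> 'a" where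
  "unit_inv x = (THE z. x * z = 1)"

lemma unit_inv_eqI:
  fixes x z :: "'a::comm_ring_1"
  assumes "x * z = 1"
  shows "unit_inv x = z"
  unfolding unit_inv_def
proof (rule the_equality)
  fix w assume "x * w = 1"
  have "w = (x * z) * w" using assms by simp
  also have "\<dots> = z * (x * w)" by (simp add: ac_simps)
  finally show "w = z" using \<open>x * w = 1\<close> by simp
qed (fact assms)

lemma yvar_unit_inv:
  "unit_inv (yvar l) = Poly_Mapping.single (Poly_Mapping.single l (- 1)) 1"
  "yvar l * unit_inv (yvar l) = 1"
proof -
  have *: "yvar l * Poly_Mapping.single (Poly_Mapping.single l (- 1)) 1 = 1"
    by (simp add: yvar_def mult_single flip: single_add)
  then show "unit_inv (yvar l) = Poly_Mapping.single (Poly_Mapping.single l (- 1)) 1"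
    by (rule unit_inv_eqI)
  with * show "yvar l * unit_inv (yvar l) = 1" by simp
qed

section \<open>Snake graphs\<close>

text \<open>
  A tile is given by its south-west corner, an edge by the set of its two end points.
  A sequence of \<open>d\<close> tiles is a function \<open>G\<close> of which only the values \<open>G 1, \<dots>, G d\<close> matter.
\<close>

type_synonym vertex = "int \<times> int"
type_synonym edge = "vertex set"
type_synonym tile = "int \<times> int"

definition south :: "tile \<Rightarrow> edge" where
  "south t = {(fst t, snd t), (fst t + 1, snd t)}"
definition north :: "tile \<Rightarrow> edge" where
  "north t = {(fst t, snd t + 1), (fst t + 1, snd t + 1)}"
definition west :: "tile \<Rightarrow> edge" where
  "west t = {(fst t, snd t), (fst t, snd t + 1)}"
definition east :: "tile \<Rightarrow> edge" where
  "east t = {(fst t + 1, snd t), (fst t + 1, snd t + 1)}"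

definition tile_edges :: "tile \<Rightarrow> edge set" where
  "tile_edges t = {south t, north t, west t, east t}"

definition snake_graph :: "nat \<Rightarrow> (nat \<Rightarrow> tile) \<Rightarrow> bool" where
  "snake_graph d G \<longleftrightarrow> d \<ge> 1 \<and>
     (\<forall>k\<in>{1..<d}. north (G k) = south (G (k + 1)) \<or> east (G k) = west (G (k + 1)))"

definition graph_edges :: "nat \<Rightarrow> (nat \<Rightarrow> tile) \<Rightarrow> edge set" where
  "graph_edges d G = (\<Union>j\<in>{1..d}. tile_edges (G j))"

definition graph_vertices :: "nat \<Rightarrow> (nat \<Rightarrow> tile) \<Rightarrow> vertex set" where
  "graph_vertices d G = \<Union> (graph_edges d G)"

datatype sign = Minus | Plus

definition sign_function :: "nat \<Rightarrow> (nat \<Rightarrow> tile) \<Rightarrow> (edge \<Rightarrow> sign) \<Rightarrow> bool" where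
  "sign_function d G f \<longleftrightarrow>
     (\<forall>j\<in>{1..d}. f (north (G j)) = f (west (G j)) \<and> f (south (G j)) = f (east (G j)) \<and>
                 f (north (G j)) \<noteq> f (south (G j)))"

text \<open>The edges \<open>e\<^sub>0, \<dots>, e\<^sub>d\<close>; the last one, \<open>ed\<close>, is a choice that is passed as an argument.\<close>

definition snake_edge :: "nat \<Rightarrow> (nat \<Rightarrow> tile) \<Rightarrow> edge \<Rightarrow> nat \<Rightarrow> edge" where
  "snake_edge d G ed k =
     (if k = 0 then south (G 1)
      else if k = d then ed
      else if north (G k) = south (G (k + 1)) then north (G k)
      else east (G k))"

section \<open>The snake graph of a continued fraction\<close>

text \<open>A continued fraction \<open>[a\<^sub>1, \<dots>, a\<^sub>n]\<close> is given by \<open>n\<close> and the values \<open>a 1, \<dots>, a n\<close>.\<close>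

definition positive_cf :: "nat \<Rightarrow> (nat \<Rightarrow> nat) \<Rightarrow> bool" where
  "positive_cf n a \<longleftrightarrow> n \<ge> 1 \<and> (\<forall>i\<in>{1..n}. a i > 0)"

definition ell :: "(nat \<Rightarrow> nat) \<Rightarrow> nat \<Rightarrow> nat" where
  "ell a i = (\<Sum>k=1..i. a k)"

text \<open>
  The \<open>i\<close>-th block of the sign sequence has length \<open>a i\<close> and occupies the edges with
  indices \<open>ell a (i - 1), \<dots>, ell a i - 1\<close>. The condition determines the sequence of tiles
  up to translation.
\<close>

definition cf_snake_graph :: "nat \<Rightarrow> (nat \<Rightarrow> nat) \<Rightarrow> (nat \<Rightarrow> tile) \<Rightarrow> bool" where
  "cf_snake_graph n a G \<longleftrightarrow>
     (let d = ell a n - 1 in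
        snake_graph d G \<and>
        (\<exists>f ed. sign_function d G f \<and> ed \<in> {north (G d), east (G d)} \<and>
           (\<forall>i\<in>{1..n}. \<forall>m\<in>{ell a (i - 1)..<ell a i}.
              f (snake_edge d G ed m) = (if odd i then Minus else Plus))))"

section \<open>Perfect matchings and the F-polynomial\<close>

definition perfect_matching :: "nat \<Rightarrow> (nat \<Rightarrow> tile) \<Rightarrow> edge set \<Rightarrow> bool" where
  "perfect_matching d G P \<longleftrightarrow>
     P \<subseteq> graph_edges d G \<and> (\<forall>v\<in>graph_vertices d G. \<exists>!e. e \<in> P \<and> v \<in> e)"

text \<open>The boundary of the union of the tiles \<open>G j\<close>, \<open>j \<in> J\<close>: the edges lying on exactly one of them.\<close>

definition union_boundary :: "(nat \<Rightarrow> tile) \<Rightarrow> nat set \<Rightarrow> edge set" where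
  "union_boundary G J = {e. \<exists>!j. j \<in> J \<and> e \<in> tile_edges (G j)}"

text \<open>
  There are exactly two perfect matchings of this kind; the minimal one is whichever
  of the two has been designated as such.
\<close>

definition boundary_matching :: "nat \<Rightarrow> (nat \<Rightarrow> tile) \<Rightarrow> edge set \<Rightarrow> bool" where
  "boundary_matching d G P \<longleftrightarrow> perfect_matching d G P \<and> P \<subseteq> union_boundary G {1..d}"

text \<open>In what follows \<open>Pm\<close> is the minimal matching.\<close>

definition enclosed_tiles ::
    "nat \<Rightarrow> (nat \<Rightarrow> tile) \<Rightarrow> edge set \<Rightarrow> edge set \<Rightarrow> nat set" where
  "enclosed_tiles d G Pm P =
     (THE J. J \<subseteq> {1..d} \<and> (P - Pm) \<union> (Pm - P) = union_boundary G J)"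

definition height_monomial ::
    "nat \<Rightarrow> (nat \<Rightarrow> tile) \<Rightarrow> (nat \<Rightarrow> 'l) \<Rightarrow> edge set \<Rightarrow> edge set \<Rightarrow> 'l laurent" where
  "height_monomial d G \<tau> Pm P = (\<Prod>j\<in>enclosed_tiles d G Pm P. yvar (\<tau> j))"

definition F_polynomial ::
    "nat \<Rightarrow> (nat \<Rightarrow> tile) \<Rightarrow> (nat \<Rightarrow> 'l) \<Rightarrow> edge set \<Rightarrow> 'l laurent" where
  "F_polynomial d G \<tau> Pm = (\<Sum>P | perfect_matching d G P. height_monomial d G \<tau> Pm P)"

section \<open>The continued fraction side\<close>

text \<open>The value \<open>1\<close> at \<open>0\<close> makes the recursion give \<open>L 1 * L 2 + 1\<close> at \<open>2\<close>.\<close>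

fun cf_numerator :: "(nat \<Rightarrow> 'a::comm_ring_1) \<Rightarrow> nat \<Rightarrow> 'a" where
  "cf_numerator L 0 = 1"
| "cf_numerator L (Suc 0) = L 1"
| "cf_numerator L (Suc (Suc n)) = L (Suc (Suc n)) * cf_numerator L (Suc n) + cf_numerator L n"

definition C_mon :: "(nat \<Rightarrow> nat) \<Rightarrow> (nat \<Rightarrow> 'l) \<Rightarrow> nat \<Rightarrow> 'l laurent" where
  "C_mon a \<tau> i =
     (if odd i then \<Prod>j=ell a 1..ell a i - 1. unit_inv (yvar (\<tau> j))
      else \<Prod>j=ell a 1..ell a (i - 1). yvar (\<tau> j))"

definition phi :: "(nat \<Rightarrow> nat) \<Rightarrow> (nat \<Rightarrow> 'l) \<Rightarrow> nat \<Rightarrow> 'l laurent" where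
  "phi a \<tau> i =
     (if odd i then \<Sum>k=ell a (i - 1) + 1..ell a i. \<Prod>j=k..ell a i - 1. yvar (\<tau> j)
      else \<Sum>k=ell a (i - 1)..ell a i - 1. \<Prod>j=ell a (i - 1) + 1..k. yvar (\<tau> j))"

definition calL :: "(nat \<Rightarrow> nat) \<Rightarrow> (nat \<Rightarrow> 'l) \<Rightarrow> nat \<Rightarrow> 'l laurent" where
  "calL a \<tau> i = phi a \<tau> i * C_mon a \<tau> i"

end

theory Submission
  imports Defs
begin

text \<open>
  Perfect matchings of a snake graph correspond to the closed sets of a fence order on its tiles, and
  the generating function of these sets obeys the recursion of the continued fraction.

  Snake graphs are built by gluing one square after another to an edge \<open>e\<^sub>k\<close>. A matching of the larger
  graph is a matching of the smaller one with the far edge of the new square added, or a matching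
  containing \<open>e\<^sub>k\<close> in which \<open>e\<^sub>k\<close> is replaced by the two side edges (\<open>matchings_glue_square\<close>). Relative
  to the minimal matching, these two possibilities say whether the new tile is enclosed. If \<open>e\<^sub>k\<close> has
  sign \<open>-\<close>, it lies in the minimal matching of the first \<open>k\<close> tiles, and the only condition is that
  tile \<open>k + 1\<close> is enclosed whenever tile \<open>k\<close> is; if it has sign \<open>+\<close>, the condition is the converse.
  Hence the perfect matchings correspond to the sets of tiles that satisfy these conditions for all
  inner edges (\<open>snake_matchings\<close>), and the \<open>F\<close>-polynomial is the sum of the monomials of the sets
  that satisfy them (\<open>F_polynomial_eq_fence_sum\<close>).

  That sum is computed by adding tiles, keeping apart the sets that contain the last tile and those
  that do not. A block of equal signs contributes one factor \<open>\<phi>\<^sub>i\<close> (\<open>fence_run_up\<close>,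
  \<open>fence_run_down\<close>), and passing from block \<open>i\<close> to block \<open>i + 1\<close> gives
  \<open>F\<^bsub>i+1\<^esub> = \<phi>\<^bsub>i+1\<^esub> y F\<^sub>i + F\<^bsub>i-1\<^esub>\<close> for odd \<open>i\<close>, where \<open>y\<close> is the indeterminate of tile \<open>\<ell>\<^sub>i\<close>, and
  \<open>F\<^bsub>i+1\<^esub> = \<phi>\<^bsub>i+1\<^esub> F\<^sub>i + Y F\<^bsub>i-1\<^esub>\<close> for even \<open>i\<close>, where \<open>Y\<close> is the product of the indeterminates of the
  tiles \<open>\<ell>\<^bsub>i-1\<^esub>, \<dots>, \<ell>\<^bsub>i+1\<^esub> - 1\<close> (\<open>fence_sum_blocks\<close>). The monomials \<open>C\<^sub>i\<close> turn both into the
  recursion of the numerators (\<open>cf_F_even\<close>, \<open>cf_F_odd\<close>).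
\<close>

section \<open>Closed sets of a fence\<close>

text \<open>
  The integers \<open>1, \<dots>, d\<close> carry a fence (zigzag) order, generated by one relation between \<open>k\<close> and
  \<open>k + 1\<close> for each \<open>k\<close>: \<open>k\<close> forces \<open>k + 1\<close> if \<open>s k\<close> holds, and \<open>k + 1\<close> forces \<open>k\<close> otherwise. The
  closed sets are the subsets that respect these relations. The index \<open>0\<close>, which is never an element,
  takes part in a relation with \<open>1\<close>, so that the recursion in \<open>d\<close> starts at the empty fence; this
  relation is void if \<open>s 0\<close> holds, which is the case for the snake graphs below.
\<close>

definition fence_sets :: "(nat \<Rightarrow> bool) \<Rightarrow> nat \<Rightarrow> nat set set" where
  "fence_sets s d = {J. J \<subseteq> {1..d} \<and>
     (\<forall>k<d. if s k then k \<in> J \<longrightarrow> Suc k \<in> J else Suc k \<in> J \<longrightarrow> k \<in> J)}"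

lemma fence_sets_0: "fence_sets s 0 = {{}}"
  by (auto simp: fence_sets_def)

lemma finite_fence_sets: "finite (fence_sets s d)"
  by (rule finite_subset[of _ "Pow {1..d}"]) (auto simp: fence_sets_def)

lemma fence_sets_subset: "J \<in> fence_sets s d \<Longrightarrow> J \<subseteq> {1..d}"
  by (simp add: fence_sets_def)

lemma Suc_notin_fence_sets: "J \<in> fence_sets s d \<Longrightarrow> Suc d \<notin> J"
  using fence_sets_subset by fastforce

lemma fence_sets_Suc_mem:
  "J \<in> fence_sets s (Suc d) \<longleftrightarrow> J \<subseteq> {1..Suc d} \<and> J - {Suc d} \<in> fence_sets s d \<and>
     (if s d then d \<in> J \<longrightarrow> Suc d \<in> J else Suc d \<in> J \<longrightarrow> d \<in> J)"
proof -
  have sub: "J - {Suc d} \<subseteq> {1..d} \<longleftrightarrow> J \<subseteq> {1..Suc d}"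
    by (simp add: atLeastAtMostSuc_conv subset_insert_iff)
  have mem: "(k \<in> J - {Suc d} \<longleftrightarrow> k \<in> J) \<and> (Suc k \<in> J - {Suc d} \<longleftrightarrow> Suc k \<in> J)"
    if "k < d" for k
    using that by simp
  have "(\<forall>k<d. if s k then k \<in> J - {Suc d} \<longrightarrow> Suc k \<in> J - {Suc d}
        else Suc k \<in> J - {Suc d} \<longrightarrow> k \<in> J - {Suc d}) \<longleftrightarrow>
      (\<forall>k<d. if s k then k \<in> J \<longrightarrow> Suc k \<in> J else Suc k \<in> J \<longrightarrow> k \<in> J)"
    by (rule all_cong1, rule imp_cong, rule refl) (simp only: mem)
  then show ?thesis
    unfolding fence_sets_def mem_Collect_eq All_less_Suc sub by blast
qed

text \<open>
  Only the membership of \<open>d\<close> matters for adding \<open>d + 1\<close>. This recursion is what the perfect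
  matchings of a snake graph are compared with in \<open>snake_matchings\<close>.
\<close>

lemma fence_sets_Suc:
  "fence_sets s (Suc d) =
    (if s d then {J \<in> fence_sets s d. d \<notin> J} \<union> insert (Suc d) ` fence_sets s d
     else fence_sets s d \<union> insert (Suc d) ` {J \<in> fence_sets s d. d \<in> J})"
    (is "_ = ?R")
proof (intro set_eqI)
  fix J
  have img: "J \<in> insert (Suc d) ` {K \<in> fence_sets s d. Q K} \<longleftrightarrow>
      Suc d \<in> J \<and> J - {Suc d} \<in> fence_sets s d \<and> Q (J - {Suc d})" for Q
  proof
    assume "J \<in> insert (Suc d) ` {K \<in> fence_sets s d. Q K}"
    then obtain K where "K \<in> fence_sets s d" "Q K" "J = insert (Suc d) K" by blast
    then show "Suc d \<in> J \<and> J - {Suc d} \<in> fence_sets s d \<and> Q (J - {Suc d})"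
      using Suc_notin_fence_sets[of K s d] by simp
  qed (auto intro!: image_eqI[of _ _ "J - {Suc d}"])
  have old: "J \<in> fence_sets s d \<longleftrightarrow> Suc d \<notin> J \<and> J - {Suc d} \<in> fence_sets s d"
    using Suc_notin_fence_sets[of J s d] by (cases "Suc d \<in> J") auto
  have all: "J \<in> insert (Suc d) ` fence_sets s d \<longleftrightarrow> Suc d \<in> J \<and> J - {Suc d} \<in> fence_sets s d"
    using img[of "\<lambda>_. True"] by simp
  have sel: "J \<in> insert (Suc d) ` {K \<in> fence_sets s d. d \<in> K} \<longleftrightarrow>
      Suc d \<in> J \<and> J - {Suc d} \<in> fence_sets s d \<and> d \<in> J"
    using img[of "\<lambda>K. d \<in> K"] by simp
  have sub: "J \<subseteq> {1..Suc d}" if "J - {Suc d} \<in> fence_sets s d"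
    using fence_sets_subset[OF that] by (subst atLeastAtMostSuc_conv) auto
  show "J \<in> fence_sets s (Suc d) \<longleftrightarrow> J \<in> ?R"
  proof (cases "s d")
    case True
    show ?thesis
      unfolding fence_sets_Suc_mem if_P[OF True] Un_iff mem_Collect_eq all using old sub by blast
  next
    case False
    show ?thesis
      unfolding fence_sets_Suc_mem if_not_P[OF False] Un_iff sel using old sub by blast
  qed
qed

text \<open>
  The generating function \<open>fence_sum\<close> of the closed sets in the weights \<open>y\<close> has two parts: \<open>fence_in\<close>
  is the sum over the sets that contain the last element, \<open>fence_out\<close> over those that do not.
\<close>

definition fence_in :: "(nat \<Rightarrow> bool) \<Rightarrow> (nat \<Rightarrow> 'a::comm_ring_1) \<Rightarrow> nat \<Rightarrow> 'a" where
  "fence_in s y d = (\<Sum>J | J \<in> fence_sets s d \<and> d \<in> J. \<Prod>j\<in>J. y j)"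

definition fence_out :: "(nat \<Rightarrow> bool) \<Rightarrow> (nat \<Rightarrow> 'a::comm_ring_1) \<Rightarrow> nat \<Rightarrow> 'a" where
  "fence_out s y d = (\<Sum>J | J \<in> fence_sets s d \<and> d \<notin> J. \<Prod>j\<in>J. y j)"

definition fence_sum :: "(nat \<Rightarrow> bool) \<Rightarrow> (nat \<Rightarrow> 'a::comm_ring_1) \<Rightarrow> nat \<Rightarrow> 'a" where
  "fence_sum s y d = (\<Sum>J\<in>fence_sets s d. \<Prod>j\<in>J. y j)"

lemma fence_sum_split: "fence_sum s y d = fence_in s y d + fence_out s y d"
  unfolding fence_sum_def fence_in_def fence_out_def
  by (subst sum.union_disjoint[symmetric]) (auto simp: finite_fence_sets intro!: sum.cong)

lemma fence_0: "fence_in s y 0 = 0" "fence_out s y 0 = 1"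
proof -
  have "{J. J \<in> fence_sets s 0 \<and> 0 \<in> J} = {}" "{J. J \<in> fence_sets s 0 \<and> 0 \<notin> J} = {{}}"
    by (auto simp: fence_sets_0)
  then show "fence_in s y 0 = 0" "fence_out s y 0 = 1"
    by (simp_all only: fence_in_def fence_out_def) simp_all
qed

lemma sum_prod_insert:
  assumes "A \<subseteq> fence_sets s d"
  shows "(\<Sum>J\<in>insert (Suc d) ` A. \<Prod>j\<in>J. y j) = y (Suc d) * (\<Sum>J\<in>A. \<Prod>j\<in>J. (y j :: 'a::comm_ring_1))"
proof -
  have no: "Suc d \<notin> J" if "J \<in> A" for J
    using that assms Suc_notin_fence_sets by blast
  have fin: "finite J" if "J \<in> A" for J
    using that assms fence_sets_subset[of J s d] finite_subset[of J "{1..d}"] by auto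
  have "inj_on (insert (Suc d)) A"
    by (rule inj_onI) (metis no insert_ident)
  then show ?thesis
    by (simp add: sum.reindex sum_distrib_left no fin)
qed

lemma fence_in_Suc:
  "fence_in s y (Suc d) = y (Suc d) * (if s d then fence_sum s y d else fence_in s y d)"
proof -
  have "{J. J \<in> fence_sets s (Suc d) \<and> Suc d \<in> J} =
      insert (Suc d) ` (if s d then fence_sets s d else {J \<in> fence_sets s d. d \<in> J})"
    by (auto simp: fence_sets_Suc dest: Suc_notin_fence_sets)
  then show ?thesis
    by (simp add: fence_in_def fence_sum_def sum_prod_insert[of _ s])
qed

lemma fence_out_Suc:
  "fence_out s y (Suc d) = (if s d then fence_out s y d else fence_sum s y d)"
proof -
  have "{J. J \<in> fence_sets s (Suc d) \<and> Suc d \<notin> J} =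
      (if s d then {J \<in> fence_sets s d. d \<notin> J} else fence_sets s d)"
    by (auto simp: fence_sets_Suc dest: Suc_notin_fence_sets)
  then show ?thesis
    by (simp add: fence_out_def fence_sum_def)
qed

text \<open>
  The effect of a run of relations in one direction. The first sum below is the shape of \<^const>\<open>phi\<close>
  at an odd index, the one in the next lemma its shape at an even index.
\<close>

lemma fence_run_up:
  assumes "p \<le> q" "\<And>k. p \<le> k \<Longrightarrow> k < q \<Longrightarrow> s k"
  shows "fence_out s y q = fence_out s y p"
    and "fence_sum s y q = (\<Prod>j=p+1..q. y j) * fence_in s y p
           + fence_out s y p * (\<Sum>k=p+1..q+1. \<Prod>j=k..q. y j)"
proof -
  have "fence_out s y q = fence_out s y p \<and>
    fence_sum s y q = (\<Prod>j=p+1..q. y j) * fence_in s y p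
           + fence_out s y p * (\<Sum>k=p+1..q+1. \<Prod>j=k..q. y j)"
    using assms
  proof (induction q rule: dec_induct)
    case base
    then show ?case by (simp add: fence_sum_split)
  next
    case (step q)
    note le = \<open>p \<le> q\<close>
    have s: "s q" using step.prems le by simp
    have IH: "fence_out s y q = fence_out s y p"
      "fence_sum s y q = (\<Prod>j=p+1..q. y j) * fence_in s y p
           + fence_out s y p * (\<Sum>k=p+1..q+1. \<Prod>j=k..q. y j)"
      using step.IH step.prems by (simp_all only: less_Suc_eq simp_thms)
    have "(\<Sum>k=p+1..Suc q+1. \<Prod>j=k..Suc q. y j) = (\<Sum>k=p+1..Suc q. \<Prod>j=k..Suc q. y j) + 1"
      using le by simp
    also have "(\<Sum>k=p+1..Suc q. \<Prod>j=k..Suc q. y j) = (\<Sum>k=p+1..Suc q. y (Suc q) * (\<Prod>j=k..q. y j))"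
      by (intro sum.cong) (auto simp: prod.cl_ivl_Suc mult.commute)
    also have "\<dots> = y (Suc q) * (\<Sum>k=p+1..q+1. \<Prod>j=k..q. y j)"
      by (simp only: sum_distrib_left Suc_eq_plus1)
    finally have 1: "(\<Sum>k=p+1..Suc q+1. \<Prod>j=k..Suc q. y j) =
        y (Suc q) * (\<Sum>k=p+1..q+1. \<Prod>j=k..q. y j) + 1" .
    have 2: "(\<Prod>j=p+1..Suc q. y j) = y (Suc q) * (\<Prod>j=p+1..q. y j)"
      using le by (simp add: prod.cl_ivl_Suc mult.commute)
    show ?case
      unfolding fence_sum_split[of s y "Suc q"] fence_in_Suc fence_out_Suc 1 2
      by (simp add: s IH algebra_simps)
  qed
  then show "fence_out s y q = fence_out s y p"
    and "fence_sum s y q = (\<Prod>j=p+1..q. y j) * fence_in s y p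
           + fence_out s y p * (\<Sum>k=p+1..q+1. \<Prod>j=k..q. y j)" by auto
qed

lemma fence_run_down:
  assumes "p \<le> q" "\<And>k. p \<le> k \<Longrightarrow> k < q \<Longrightarrow> \<not> s k"
  shows "fence_in s y q = (\<Prod>j=p+1..q. y j) * fence_in s y p"
    and "fence_sum s y q = fence_out s y p + fence_in s y p * (\<Sum>k=p..q. \<Prod>j=p+1..k. y j)"
proof -
  have "fence_in s y q = (\<Prod>j=p+1..q. y j) * fence_in s y p \<and>
    fence_sum s y q = fence_out s y p + fence_in s y p * (\<Sum>k=p..q. \<Prod>j=p+1..k. y j)"
    using assms
  proof (induction q rule: dec_induct)
    case base
    then show ?case by (simp add: fence_sum_split)
  next
    case (step q)
    note le = \<open>p \<le> q\<close>
    have s: "\<not> s q" using step.prems le by simp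
    have IH: "fence_in s y q = (\<Prod>j=p+1..q. y j) * fence_in s y p"
     "fence_sum s y q = fence_out s y p + fence_in s y p * (\<Sum>k=p..q. \<Prod>j=p+1..k. y j)"
      using step.IH step.prems by (simp_all only: less_Suc_eq simp_thms)
    have 1: "(\<Sum>k=p..Suc q. \<Prod>j=p+1..k. y j) = (\<Sum>k=p..q. \<Prod>j=p+1..k. y j) + (\<Prod>j=p+1..Suc q. y j)"
      using le by simp
    have 2: "(\<Prod>j=p+1..Suc q. y j) = y (Suc q) * (\<Prod>j=p+1..q. y j)"
      using le by (simp add: prod.cl_ivl_Suc mult.commute)
    show ?case
      unfolding fence_sum_split[of s y "Suc q"] fence_in_Suc fence_out_Suc 1 2
      by (simp add: s IH algebra_simps)
  qed
  then show "fence_in s y q = (\<Prod>j=p+1..q. y j) * fence_in s y p"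
    and "fence_sum s y q = fence_out s y p + fence_in s y p * (\<Sum>k=p..q. \<Prod>j=p+1..k. y j)" by auto
qed

section \<open>Evaluation of the generating function by continued fractions\<close>

lemma C_mon_units:
  assumes "odd i"
  shows "C_mon a \<tau> i * (\<Prod>j=ell a 1..ell a i - 1. yvar (\<tau> j)) = 1"
    and "unit_inv (C_mon a \<tau> i) = (\<Prod>j=ell a 1..ell a i - 1. yvar (\<tau> j))"
proof -
  show *: "C_mon a \<tau> i * (\<Prod>j=ell a 1..ell a i - 1. yvar (\<tau> j)) = 1"
    using assms
    by (simp add: C_mon_def yvar_unit_inv(2) mult.commute[of "unit_inv _"] flip: prod.distrib)
  show "unit_inv (C_mon a \<tau> i) = (\<Prod>j=ell a 1..ell a i - 1. yvar (\<tau> j))"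
    by (rule unit_inv_eqI) (rule *)
qed

text \<open>
  The claimed value of the \<open>F\<close>-polynomial for the truncation \<open>[a\<^sub>1, \<dots>, a\<^sub>i]\<close>; it is \<open>1\<close> at \<open>i = 0\<close>.
\<close>

definition cf_F :: "(nat \<Rightarrow> nat) \<Rightarrow> (nat \<Rightarrow> 'l) \<Rightarrow> nat \<Rightarrow> 'l laurent" where
  "cf_F a \<tau> i =
     (if odd i then unit_inv (C_mon a \<tau> i) * cf_numerator (calL a \<tau>) i
      else cf_numerator (calL a \<tau>) i)"

lemma ell_Suc: "ell a (Suc i) = ell a i + a (Suc i)"
  by (simp add: ell_def)

lemma ell_mono: "i \<le> j \<Longrightarrow> ell a i \<le> ell a j"
  unfolding ell_def by (rule sum_mono2) auto

lemma cf_F_0: "cf_F a \<tau> 0 = 1"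
  by (simp add: cf_F_def)

lemma cf_F_1: "cf_F a \<tau> (Suc 0) = phi a \<tau> (Suc 0)"
proof -
  have "cf_F a \<tau> (Suc 0) = phi a \<tau> (Suc 0) *
      (C_mon a \<tau> (Suc 0) * (\<Prod>j=ell a 1..ell a (Suc 0) - 1. yvar (\<tau> j)))"
    by (simp add: cf_F_def calL_def C_mon_units(2) mult_ac)
  then show ?thesis using C_mon_units(1)[of "Suc 0" a \<tau>] by simp
qed

text \<open>
  The recursion of \<^const>\<open>cf_numerator\<close> in terms of \<^const>\<open>cf_F\<close>. The monomials \<^const>\<open>C_mon\<close>
  combine to products of indeterminates over intervals of tiles, without negative exponents.
\<close>

lemma cf_F_even:
  assumes "odd i" "a 1 > 0"
  shows "cf_F a \<tau> (Suc i) = phi a \<tau> (Suc i) * yvar (\<tau> (ell a i)) * cf_F a \<tau> i + cf_F a \<tau> (i - 1)"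
proof -
  obtain k where i: "i = Suc k" using assms(1) by (cases i) auto
  have pos: "ell a 1 \<le> ell a i" "0 < ell a i"
    using ell_mono[of 1 i a] assms(2) by (auto simp: i ell_def)
  have C: "C_mon a \<tau> (Suc i) = yvar (\<tau> (ell a i)) * (\<Prod>j=ell a 1..ell a i - 1. yvar (\<tau> j))"
  proof -
    have "{ell a 1..ell a i} = insert (ell a i) {ell a 1..ell a i - 1}" using pos by auto
    then show ?thesis using assms(1) pos by (simp add: C_mon_def)
  qed
  have N: "cf_numerator (calL a \<tau>) (Suc i) =
      phi a \<tau> (Suc i) * C_mon a \<tau> (Suc i) * cf_numerator (calL a \<tau>) i + cf_numerator (calL a \<tau>) k"
    by (simp add: i calL_def)
  have k: "i - Suc 0 = k" "even k" using i assms(1) by auto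
  show ?thesis
    using assms(1) by (simp add: cf_F_def N C C_mon_units(2) k mult_ac del: cf_numerator.simps)
qed

lemma cf_F_odd:
  assumes "even i" "i \<ge> 2" "a 1 > 0"
  shows "cf_F a \<tau> (Suc i) = phi a \<tau> (Suc i) * cf_F a \<tau> i
      + (\<Prod>j=ell a (i - 1)..ell a (Suc i) - 1. yvar (\<tau> j)) * cf_F a \<tau> (i - 1)"
proof -
  obtain k where i: "i = Suc k" and k: "odd k" using assms(1,2) by (cases i) auto
  let ?D = "\<lambda>i. \<Prod>j=ell a 1..ell a i - 1. yvar (\<tau> j)"
  have pos: "0 < ell a 1" "ell a 1 \<le> ell a k" "ell a k \<le> ell a (Suc i)"
    using ell_mono[of 1 k a] ell_mono[of k "Suc i" a] assms(3) k i by (auto simp: ell_def odd_pos Suc_leI)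
  have "{ell a 1..ell a (Suc i) - 1} = {ell a 1..ell a k - 1} \<union> {ell a k..ell a (Suc i) - 1}"
    using pos by auto
  then have D: "?D (Suc i) = ?D k * (\<Prod>j=ell a k..ell a (Suc i) - 1. yvar (\<tau> j))"
    using pos(1,2) by (simp only:) (rule prod.union_disjoint, auto)
  have N: "cf_numerator (calL a \<tau>) (Suc i) =
      phi a \<tau> (Suc i) * C_mon a \<tau> (Suc i) * cf_numerator (calL a \<tau>) i + cf_numerator (calL a \<tau>) k"
    by (simp add: i calL_def)
  have "cf_F a \<tau> (Suc i) = (C_mon a \<tau> (Suc i) * ?D (Suc i)) * (phi a \<tau> (Suc i) * cf_F a \<tau> i)
      + ?D (Suc i) * cf_numerator (calL a \<tau>) k"
    using assms(1) k by (simp add: cf_F_def C_mon_units(2) N algebra_simps del: cf_numerator.simps)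
  also have "?D (Suc i) * cf_numerator (calL a \<tau>) k =
      (\<Prod>j=ell a k..ell a (Suc i) - 1. yvar (\<tau> j)) * cf_F a \<tau> k"
    using k unfolding D by (simp add: cf_F_def C_mon_units(2) mult_ac)
  finally show ?thesis
    using assms(1) C_mon_units(1)[of "Suc i" a \<tau>] by (simp add: i)
qed

text \<open>
  Let the direction \<open>s\<close> be constant on each block of the sign sequence. The tile \<open>ell a i - 1\<close> is the
  last one before the last edge of the \<open>i\<close>-th block, so that one more relation in the direction of
  block \<open>i\<close> follows it before the run of block \<open>i + 1\<close>. That relation needs
  one of the two parts of the generating function at \<open>ell a i - 1\<close>, and this part is the multiple of
  the previous value \<open>cf_F a \<tau> (i - 1)\<close> that the recursion of \<^const>\<open>cf_F\<close> asks for. Hence the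
  strengthening of the induction statement.
\<close>

lemma fence_sum_blocks:
  fixes \<tau> :: "nat \<Rightarrow> 'l"
  assumes cf: "positive_cf n a"
    and s: "\<And>i m. 1 \<le> i \<Longrightarrow> i \<le> n \<Longrightarrow> ell a (i - 1) \<le> m \<Longrightarrow> m < ell a i \<Longrightarrow> s m \<longleftrightarrow> odd i"
  defines "y \<equiv> \<lambda>j. yvar (\<tau> j) :: 'l laurent"
  assumes i: "1 \<le> i" "i \<le> n"
  shows "fence_sum s y (ell a i - 1) = cf_F a \<tau> i \<and>
    (odd i \<longrightarrow> fence_out s y (ell a i - 1) = cf_F a \<tau> (i - 1)) \<and>
    (even i \<longrightarrow> fence_in s y (ell a i - 1) =
       (\<Prod>j=ell a (i - 1)..ell a i - 1. y j) * cf_F a \<tau> (i - 1))"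
  using i
proof (induction i rule: dec_induct)
  case base
  have a1: "a 1 > 0" "1 \<le> n" using cf by (auto simp: positive_cf_def)
  have up: "s k" if "0 \<le> k" "k < a 1 - 1" for k
    using s[of 1 k] a1 that by (simp add: ell_def)
  have "fence_sum s y (a 1 - 1) = phi a \<tau> 1"
    using a1 by (subst fence_run_up(2)[OF _ up, where p = 0]) (simp_all add: fence_0 phi_def ell_def y_def)
  moreover have "fence_out s y (a 1 - 1) = 1"
    by (subst fence_run_up(1)[OF _ up, where p = 0]) (simp_all add: fence_0)
  ultimately show ?case
    by (simp add: cf_F_0 cf_F_1 ell_def)
next
  case (step i)
  have a: "a j > 0" if "1 \<le> j" "j \<le> n" for j using cf that by (auto simp: positive_cf_def)
  have in': "1 \<le> i" "Suc i \<le> n" "i \<le> n" using step.prems step.hyps by auto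
  let ?p = "ell a i" and ?q = "ell a (Suc i) - 1"
  have p: "?p > 0" using a[of i] in' ell_Suc[of a "i - 1"] by simp
  have pq: "?p \<le> ?q" using a[of "Suc i"] in' ell_Suc[of a i] by simp
  have Sp: "Suc (?p - 1) = ?p" using p by simp
  have sp: "s (?p - 1) \<longleftrightarrow> odd i"
    using s[of i "?p - 1"] in' p a[of i] ell_Suc[of a "i - 1"] by auto
  have run: "s k \<longleftrightarrow> even i" if "?p \<le> k" "k < ?q" for k
    using s[of "Suc i" k] in' that by auto
  have IH: "fence_sum s y (?p - 1) = cf_F a \<tau> i"
    "odd i \<Longrightarrow> fence_out s y (?p - 1) = cf_F a \<tau> (i - 1)"
    "even i \<Longrightarrow> fence_in s y (?p - 1) = (\<Prod>j=ell a (i - 1)..?p - 1. y j) * cf_F a \<tau> (i - 1)"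
    using step.IH in' by auto
  \<comment> \<open>the relation between the tiles \<open>?p - 1\<close> and \<open>?p\<close> still belongs to block \<open>i\<close>\<close>
  have step_in: "fence_in s y ?p = y ?p * (if odd i then cf_F a \<tau> i else fence_in s y (?p - 1))"
    using fence_in_Suc[of s y "?p - 1"] unfolding Sp sp IH(1) .
  have step_out: "fence_out s y ?p = (if odd i then fence_out s y (?p - 1) else cf_F a \<tau> i)"
    using fence_out_Suc[of s y "?p - 1"] unfolding Sp sp IH(1) .
  have y: "yvar (\<tau> j) = y j" for j by (simp add: y_def)
  show ?case
  proof (cases "even i")
    case True
    then have up: "\<And>k. ?p \<le> k \<Longrightarrow> k < ?q \<Longrightarrow> s k" using run by blast
    have i2: "i \<ge> 2" using True in' by (cases "i = 1") auto
    have le: "ell a (i - 1) \<le> ?p" by (rule ell_mono) simp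
    have "{ell a (i - 1)..?q} = insert ?p ({ell a (i - 1)..?p - 1} \<union> {?p + 1..?q})"
      using le pq p by auto
    moreover have "(\<Prod>j\<in>insert ?p ({ell a (i - 1)..?p - 1} \<union> {?p + 1..?q}). y j) =
        y ?p * ((\<Prod>j=ell a (i - 1)..?p - 1. y j) * (\<Prod>j=?p + 1..?q. y j))"
      using p by (subst prod.insert) (auto simp: prod.union_disjoint)
    ultimately have pr: "(\<Prod>j=ell a (i - 1)..?q. y j) =
        y ?p * ((\<Prod>j=ell a (i - 1)..?p - 1. y j) * (\<Prod>j=?p + 1..?q. y j))"
      by simp
    have ph: "phi a \<tau> (Suc i) = (\<Sum>k=?p+1..?q+1. \<Prod>j=k..?q. y j)"
      using True pq p by (simp add: phi_def y_def)
    have "fence_sum s y ?q = cf_F a \<tau> (Suc i)"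
      using True i2 a[of 1] in'
      by (simp only: fence_run_up(2)[OF pq up] flip: ph)
        (simp add: cf_F_odd step_in step_out IH[unfolded One_nat_def] pr[simplified] y algebra_simps)
    moreover have "fence_out s y ?q = cf_F a \<tau> i"
      using True by (simp only: fence_run_up(1)[OF pq up] step_out) simp
    ultimately show ?thesis using True by simp
  next
    case False
    then have down: "\<And>k. ?p \<le> k \<Longrightarrow> k < ?q \<Longrightarrow> \<not> s k" using run by blast
    have ph: "phi a \<tau> (Suc i) = (\<Sum>k=?p..?q. \<Prod>j=?p+1..k. y j)"
      using False by (simp add: phi_def y_def)
    have pr: "(\<Prod>j=?p..?q. y j) = y ?p * (\<Prod>j=?p+1..?q. y j)"
      using pq by (simp add: prod.atLeast_Suc_atMost)
    have "fence_sum s y ?q = cf_F a \<tau> (Suc i)"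
      using False a[of 1] in'
      by (simp only: fence_run_down(2)[OF pq down] flip: ph)
        (simp add: cf_F_even step_in step_out IH[unfolded One_nat_def] y algebra_simps)
    moreover have "fence_in s y ?q = (\<Prod>j=?p..?q. y j) * cf_F a \<tau> i"
      using False by (simp only: fence_run_down(1)[OF pq down] step_in pr) (simp add: mult_ac)
    ultimately show ?thesis using False by simp
  qed
qed

section \<open>Matchings of a graph with a square glued to an edge\<close>

text \<open>
  The perfect matchings of the graph with edge set \<open>E\<close>, as sets of pairwise disjoint edges of \<open>E\<close>
  covering the vertices; the vertices are those lying on an edge.
\<close>

definition matchings :: "'v set set \<Rightarrow> 'v set set set" where
  "matchings E = {P. P \<subseteq> E \<and> \<Union>E \<subseteq> \<Union>P \<and> (\<forall>x\<in>P. \<forall>y\<in>P. \<forall>w\<in>x. w \<in> y \<longrightarrow> x = y)}"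

lemma matchingsI:
  assumes "P \<subseteq> E" "\<And>w. w \<in> \<Union>E \<Longrightarrow> \<exists>x\<in>P. w \<in> x"
    "\<And>x y w. x \<in> P \<Longrightarrow> y \<in> P \<Longrightarrow> w \<in> x \<Longrightarrow> w \<in> y \<Longrightarrow> x = y"
  shows "P \<in> matchings E"
  unfolding matchings_def mem_Collect_eq
  using assms by (intro conjI ballI impI) blast+

lemma matchingsD:
  assumes "P \<in> matchings E"
  shows "P \<subseteq> E" "\<And>w. w \<in> \<Union>E \<Longrightarrow> \<exists>x\<in>P. w \<in> x"
    "\<And>x y w. x \<in> P \<Longrightarrow> y \<in> P \<Longrightarrow> w \<in> x \<Longrightarrow> w \<in> y \<Longrightarrow> x = y"
  using assms unfolding matchings_def mem_Collect_eq by blast+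

lemma perfect_matching_iff: "perfect_matching d G P \<longleftrightarrow> P \<in> matchings (graph_edges d G)"
proof
  assume "perfect_matching d G P"
  then have P: "P \<subseteq> graph_edges d G" "\<And>w. w \<in> \<Union>(graph_edges d G) \<Longrightarrow> \<exists>!x. x \<in> P \<and> w \<in> x"
    unfolding perfect_matching_def graph_vertices_def by blast+
  show "P \<in> matchings (graph_edges d G)"
  proof (rule matchingsI)
    show "\<exists>x\<in>P. w \<in> x" if "w \<in> \<Union>(graph_edges d G)" for w
      using P(2)[OF that] by blast
    show "x = y" if "x \<in> P" "y \<in> P" "w \<in> x" "w \<in> y" for x y w
      using P(2)[of w] P(1) that by blast
  qed (fact P)
next
  assume "P \<in> matchings (graph_edges d G)"
  note P = matchingsD[OF this]
  show "perfect_matching d G P"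
    unfolding perfect_matching_def graph_vertices_def
  proof (intro conjI ballI)
    fix w assume "w \<in> \<Union>(graph_edges d G)"
    from P(2)[OF this] P(3) show "\<exists>!e. e \<in> P \<and> w \<in> e" by blast
  qed (fact P)
qed

text \<open>
  Glue a square with the new vertices \<open>u'\<close> and \<open>v'\<close> to the edge \<open>{u, v}\<close>. A matching of the larger
  graph covers the new vertices either by the far edge \<open>{u', v'}\<close>, and the rest is a matching of \<open>E\<close>,
  or by the two side edges; then \<open>u\<close> and \<open>v\<close> are covered too, and putting \<open>{u, v}\<close> in place of the
  side edges gives a matching of \<open>E\<close> containing \<open>{u, v}\<close>.
\<close>

lemma matchings_glue_square:
  fixes u v u' v' :: 'v
  assumes e: "{u, v} \<in> E" and uv: "u \<noteq> v" "u' \<noteq> v'" and new: "u' \<notin> \<Union>E" "v' \<notin> \<Union>E"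
  shows "matchings (E \<union> {{u, u'}, {v, v'}, {u', v'}}) =
    insert {u', v'} ` matchings E \<union>
    (\<lambda>P. P - {{u, v}} \<union> {{u, u'}, {v, v'}}) ` {P \<in> matchings E. {u, v} \<in> P}"
    (is "matchings ?E = ?A \<union> ?B")
proof -
  have ne: "u \<in> \<Union>E" "v \<in> \<Union>E" using e by auto
  have dist: "u \<noteq> u'" "u \<noteq> v'" "v \<noteq> u'" "v \<noteq> v'" using ne new by auto
  have edges_ne: "{u, u'} \<noteq> {u', v'}" "{v, v'} \<noteq> {u', v'}" "{u, u'} \<noteq> {v, v'}"
    "{u, v} \<noteq> {u, u'}" "{u, v} \<noteq> {v, v'}"
    using dist uv by (auto simp: doubleton_eq_iff)
  have vE': "w \<in> \<Union>?E \<longleftrightarrow> w \<in> \<Union>E \<or> w = u' \<or> w = v'" for w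
    using ne by auto
  have new': "u' \<notin> x" "v' \<notin> x" if "x \<in> E" for x using new that by auto
  have 1: "P \<in> ?A \<union> ?B" if "P \<in> matchings ?E" for P
  proof -
    note P = matchingsD[OF that]
    show ?thesis
    proof (cases "{u', v'} \<in> P")
      case True
      have no: "{u, u'} \<notin> P" "{v, v'} \<notin> P"
        using P(3)[OF True, of "{u, u'}" u'] P(3)[OF True, of "{v, v'}" v'] edges_ne by auto
      let ?Q = "P - {{u', v'}}"
      have "?Q \<in> matchings E"
      proof (rule matchingsI)
        show "?Q \<subseteq> E" using P(1) no by auto
        show "\<exists>x\<in>?Q. w \<in> x" if w: "w \<in> \<Union>E" for w
        proof -
          obtain x where "x \<in> P" "w \<in> x" using P(2)[of w] vE' w by blast
          moreover have "w \<noteq> u'" "w \<noteq> v'" using new w by auto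
          ultimately show ?thesis by auto
        qed
        show "x = y" if "x \<in> ?Q" "y \<in> ?Q" "w \<in> x" "w \<in> y" for x y w
          using that P(3)[of x y w] by blast
      qed
      moreover have "P = insert {u', v'} ?Q" using True by auto
      ultimately show ?thesis by blast
    next
      case False
      have new_edge: "x = {u, u'} \<or> x = {v, v'}" if "x \<in> P" "u' \<in> x \<or> v' \<in> x" for x
        using that P(1) new' False by blast
      have u: "{u, u'} \<in> P"
        using P(2)[of u'] new_edge dist uv by auto
      have v: "{v, v'} \<in> P"
        using P(2)[of v'] new_edge dist uv by auto
      let ?Q = "insert {u, v} (P - {{u, u'}, {v, v'}})"
      have uvP: "{u, v} \<notin> P" using P(3)[OF u, of "{u, v}" u] edges_ne by auto
      have other: "x \<in> P - {{u, u'}, {v, v'}} \<Longrightarrow> u \<notin> x \<and> v \<notin> x" for x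
        using P(3)[OF u, of x u] P(3)[OF v, of x v] by blast
      have "?Q \<in> matchings E"
      proof (rule matchingsI)
        show "?Q \<subseteq> E" using P(1) e False by auto
        show "\<exists>x\<in>?Q. w \<in> x" if w: "w \<in> \<Union>E" for w
        proof -
          obtain x where "x \<in> P" "w \<in> x" using P(2)[of w] vE' w by blast
          moreover have "w \<noteq> u'" "w \<noteq> v'" using new w by auto
          ultimately show ?thesis by auto
        qed
        show "x = y" if "x \<in> ?Q" "y \<in> ?Q" "w \<in> x" "w \<in> y" for x y w
          using that P(3)[of x y w] other[of x] other[of y] by auto
      qed
      moreover have "P = ?Q - {{u, v}} \<union> {{u, u'}, {v, v'}}" using u v uvP by auto
      ultimately show ?thesis by blast
    qed
  qed
  have 2: "insert {u', v'} Q \<in> matchings ?E" if "Q \<in> matchings E" for Q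
  proof (rule matchingsI)
    note Q = matchingsD[OF that]
    show "insert {u', v'} Q \<subseteq> ?E" using Q(1) by auto
    show "\<exists>x\<in>insert {u', v'} Q. w \<in> x" if "w \<in> \<Union>?E" for w
      using that[unfolded vE'] Q(2)[of w] by auto
    show "x = y" if "x \<in> insert {u', v'} Q" "y \<in> insert {u', v'} Q" "w \<in> x" "w \<in> y" for x y w
      using that Q(3)[of x y w] Q(1) new'[of x] new'[of y] by auto
  qed
  have 3: "Q - {{u, v}} \<union> {{u, u'}, {v, v'}} \<in> matchings ?E" (is "?P \<in> _")
    if "Q \<in> matchings E" "{u, v} \<in> Q" for Q
  proof (rule matchingsI)
    note Q = matchingsD[OF that(1)]
    have other: "u \<notin> x \<and> v \<notin> x \<and> u' \<notin> x \<and> v' \<notin> x" if "x \<in> Q - {{u, v}}" for x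
      using Q(3)[of "{u, v}" x] \<open>{u, v} \<in> Q\<close> that new'[of x] Q(1) by blast
    show "?P \<subseteq> ?E" using Q(1) by auto
    show "\<exists>x\<in>?P. w \<in> x" if "w \<in> \<Union>?E" for w
      using that[unfolded vE'] Q(2)[of w] by auto
    show "x = y" if "x \<in> ?P" "y \<in> ?P" "w \<in> x" "w \<in> y" for x y w
      using that Q(3)[of x y w] other[of x] other[of y] dist uv by auto
  qed
  show ?thesis
    using 1 2 3 by blast
qed

section \<open>Snake graphs as iterated gluings of squares\<close>

lemma north_eq_south_iff: "north s = south t \<longleftrightarrow> t = (fst s, snd s + 1)"
  by (cases s; cases t) (auto simp: north_def south_def doubleton_eq_iff)

lemma east_eq_west_iff: "east s = west t \<longleftrightarrow> t = (fst s + 1, snd s)"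
  by (cases s; cases t) (auto simp: east_def west_def doubleton_eq_iff)

lemma snake_graph_step:
  assumes "snake_graph d G" "1 \<le> k" "k < d"
  shows "G (Suc k) = (fst (G k), snd (G k) + 1) \<or> G (Suc k) = (fst (G k) + 1, snd (G k))"
  using assms unfolding snake_graph_def by (auto simp: north_eq_south_iff east_eq_west_iff)

lemma snake_graph_mono:
  assumes "snake_graph d G" "1 \<le> i" "i \<le> j" "j \<le> d"
  shows "fst (G i) \<le> fst (G j) \<and> snd (G i) \<le> snd (G j) \<and>
    fst (G j) + snd (G j) = fst (G i) + snd (G i) + int (j - i)"
  using assms(3,4)
proof (induction j rule: dec_induct)
  case (step k)
  then show ?case
    using snake_graph_step[OF assms(1), of k] assms(2) by (auto simp: Suc_diff_le)
qed simp

lemma tile_edges_corner: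
  "x \<in> tile_edges t \<Longrightarrow> w \<in> x \<Longrightarrow> fst w \<le> fst t + 1 \<and> snd w \<le> snd t + 1"
  by (auto simp: tile_edges_def north_def south_def east_def west_def)

text \<open>
  A tile after the first is a square glued to an edge \<open>e = {u, v}\<close>, with new vertices \<open>u'\<close> and \<open>v'\<close>.
  Call the north and the east edge of a tile its exits. Taking for \<open>v\<close> the north-east corner of the
  previous tile makes \<open>{v, v'}\<close> and \<open>{u', v'}\<close> the exits of the new tile, the first with the sign of
  \<open>e\<close> and the second with the opposite sign, whether the tile is glued to the north or to the east.
\<close>

lemma snake_square:
  assumes G: "snake_graph d G" and k: "1 \<le> k" "k < d" and e: "e = snake_edge d G ed k"
  obtains u v u' v' where
    "e = {u, v}" "u \<noteq> v" "u' \<noteq> v'" "u' \<notin> graph_vertices k G" "v' \<notin> graph_vertices k G"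
    "tile_edges (G (Suc k)) = {{u, v}, {u, u'}, {v, v'}, {u', v'}}"
    "{north (G (Suc k)), east (G (Suc k))} = {{v, v'}, {u', v'}}"
    "\<And>f. sign_function d G f \<Longrightarrow> f {v, v'} = f e \<and> f {u', v'} \<noteq> f e"
    "e \<in> {north (G k), east (G k)}"
    "\<And>j. 1 \<le> j \<Longrightarrow> j < k \<Longrightarrow> e \<notin> tile_edges (G j)"
proof -
  obtain x y where xy: "G k = (x, y)" by fastforce
  have bound: "fst w \<le> x + 1 \<and> snd w \<le> y + 1" if w: "w \<in> graph_vertices k G" for w
  proof -
    obtain j z where "j \<in> {1..k}" "z \<in> tile_edges (G j)" "w \<in> z"
      using w by (auto simp: graph_vertices_def graph_edges_def)
    then show ?thesis
      using tile_edges_corner[of z "G j" w] snake_graph_mono[OF G, of j k] k xy by auto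
  qed
  \<comment> \<open>the north-east corner of tile \<open>k\<close> lies on no earlier tile\<close>
  have old: "z \<notin> tile_edges (G j)" if "(x + 1, y + 1) \<in> z" "1 \<le> j" "j < k" for j z
  proof
    assume "z \<in> tile_edges (G j)"
    then show False
      using tile_edges_corner[of z "G j" "(x + 1, y + 1)"] snake_graph_mono[OF G, of j k] that k xy
      by auto
  qed
  have sgn: "f (north (G (Suc k))) = f (west (G (Suc k))) \<and> f (south (G (Suc k))) = f (east (G (Suc k)))
    \<and> f (north (G (Suc k))) \<noteq> f (south (G (Suc k)))" if "sign_function d G f" for f
    using that k unfolding sign_function_def by (elim ballE[of _ _ "Suc k"]) auto
  show ?thesis
  proof (cases "north (G k) = south (G (Suc k))")
    case True
    then have e': "e = north (G k)" and G': "G (Suc k) = (x, y + 1)"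
      using e k by (auto simp: snake_edge_def north_eq_south_iff xy)
    have es: "e = south (G (Suc k))" using True e' by simp
    show ?thesis
    proof (rule that[of "(x, y + 1)" "(x + 1, y + 1)" "(x, y + 1 + 1)" "(x + 1, y + 1 + 1)"])
      show "e = {(x, y + 1), (x + 1, y + 1)}" by (simp add: e' north_def xy)
      then show "e \<notin> tile_edges (G j)" if "1 \<le> j" "j < k" for j using old[OF _ that] by simp
      show "f {(x + 1, y + 1), (x + 1, y + 1 + 1)} = f e \<and> f {(x, y + 1 + 1), (x + 1, y + 1 + 1)} \<noteq> f e"
        if "sign_function d G f" for f
        using sgn[OF that] unfolding es by (auto simp: G' north_def south_def east_def)
    qed (use bound[of "(x, y + 1 + 1)"] bound[of "(x + 1, y + 1 + 1)"] e' in
        \<open>auto simp: G' tile_edges_def north_def south_def east_def west_def\<close>)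
  next
    case False
    then have e': "e = east (G k)" and ew: "east (G k) = west (G (Suc k))"
      using e k G by (auto simp: snake_edge_def snake_graph_def)
    then have G': "G (Suc k) = (x + 1, y)" by (auto simp: east_eq_west_iff xy)
    have es: "e = west (G (Suc k))" using ew e' by simp
    show ?thesis
    proof (rule that[of "(x + 1, y)" "(x + 1, y + 1)" "(x + 1 + 1, y)" "(x + 1 + 1, y + 1)"])
      show "e = {(x + 1, y), (x + 1, y + 1)}" by (simp add: e' east_def xy)
      then show "e \<notin> tile_edges (G j)" if "1 \<le> j" "j < k" for j using old[OF _ that] by simp
      show "f {(x + 1, y + 1), (x + 1 + 1, y + 1)} = f e \<and> f {(x + 1 + 1, y), (x + 1 + 1, y + 1)} \<noteq> f e"
        if "sign_function d G f" for f
        using sgn[OF that] unfolding es by (auto simp: G' north_def west_def east_def)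
    qed (use bound[of "(x + 1 + 1, y)"] bound[of "(x + 1 + 1, y + 1)"] e' in
        \<open>auto simp: G' tile_edges_def north_def south_def east_def west_def\<close>)
  qed
qed

section \<open>Boundaries of unions of tiles\<close>

lemma union_boundary_insert:
  assumes "m \<notin> J"
    and "\<And>x i j. x \<in> tile_edges (G m) \<Longrightarrow> i \<in> J \<Longrightarrow> j \<in> J \<Longrightarrow>
      x \<in> tile_edges (G i) \<Longrightarrow> x \<in> tile_edges (G j) \<Longrightarrow> i = j"
  shows "union_boundary G (insert m J) = sym_diff (union_boundary G J) (tile_edges (G m))"
proof (intro set_eqI)
  fix x
  show "x \<in> union_boundary G (insert m J) \<longleftrightarrow> x \<in> sym_diff (union_boundary G J) (tile_edges (G m))"
  proof (cases "x \<in> tile_edges (G m)")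
    case True
    have "x \<in> union_boundary G (insert m J) \<longleftrightarrow> (\<forall>j\<in>J. x \<notin> tile_edges (G j))"
      using True assms(1) unfolding union_boundary_def by blast
    moreover have "x \<in> union_boundary G J \<longleftrightarrow> (\<exists>j\<in>J. x \<in> tile_edges (G j))"
      using assms(2)[OF True] unfolding union_boundary_def by blast
    ultimately show ?thesis using True by blast
  next
    case False
    then have "x \<in> union_boundary G (insert m J) \<longleftrightarrow> x \<in> union_boundary G J"
      unfolding union_boundary_def mem_Collect_eq by (metis insert_iff)
    then show ?thesis using False by blast
  qed
qed

lemma union_boundary_empty: "union_boundary G {} = {}"
  by (auto simp: union_boundary_def)

lemma union_boundary_singleton: "union_boundary G {j} = tile_edges (G j)"
  by (auto simp: union_boundary_def)

lemma union_boundary_subset: "J \<subseteq> {1..k} \<Longrightarrow> union_boundary G J \<subseteq> graph_edges k G"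
  by (auto simp: union_boundary_def graph_edges_def)

lemma graph_edges_Suc: "graph_edges (Suc k) G = graph_edges k G \<union> tile_edges (G (Suc k))"
  by (simp add: graph_edges_def atLeastAtMostSuc_conv Un_commute)

text \<open>
  The same data in terms of edges only: the new tile has the edges \<open>e\<close>, two sides \<open>a\<close> and \<open>b\<close>, and
  the far edge \<open>c\<close>, and the exits from it are \<open>b\<close> and \<open>c\<close>. Adding the tile to a set of tiles
  changes the boundary by symmetric difference.
\<close>

lemma snake_tile:
  assumes G: "snake_graph d G" and k: "1 \<le> k" "k < d" and e: "e = snake_edge d G ed k"
  obtains a b c where
    "tile_edges (G (Suc k)) = {e, a, b, c}" "a \<noteq> b" "a \<noteq> c" "b \<noteq> c"
    "a \<notin> graph_edges k G" "b \<notin> graph_edges k G" "c \<notin> graph_edges k G"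
    "e \<in> tile_edges (G k)" "e \<in> {north (G k), east (G k)}"
    "{north (G (Suc k)), east (G (Suc k))} = {b, c}"
    "\<And>f. sign_function d G f \<Longrightarrow> f b = f e \<and> f c \<noteq> f e"
    "matchings (graph_edges (Suc k) G) = insert c ` matchings (graph_edges k G) \<union>
      (\<lambda>P. P - {e} \<union> {a, b}) ` {P \<in> matchings (graph_edges k G). e \<in> P}"
    "\<And>J. J \<subseteq> {1..k} \<Longrightarrow> union_boundary G (insert (Suc k) J) =
       sym_diff (union_boundary G J) {e, a, b, c}"
    "\<And>J. J \<subseteq> {1..k} \<Longrightarrow> e \<in> union_boundary G J \<longleftrightarrow> k \<in> J"
proof -
  obtain u v u' v' where sq:
    "e = {u, v}" "u \<noteq> v" "u' \<noteq> v'" "u' \<notin> graph_vertices k G" "v' \<notin> graph_vertices k G"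
    "tile_edges (G (Suc k)) = {{u, v}, {u, u'}, {v, v'}, {u', v'}}"
    "{north (G (Suc k)), east (G (Suc k))} = {{v, v'}, {u', v'}}"
    "\<And>f. sign_function d G f \<Longrightarrow> f {v, v'} = f e \<and> f {u', v'} \<noteq> f e"
    "e \<in> {north (G k), east (G k)}"
    "\<And>j. 1 \<le> j \<Longrightarrow> j < k \<Longrightarrow> e \<notin> tile_edges (G j)"
    by (rule snake_square[OF assms]) blast
  have ek: "e \<in> tile_edges (G k)" using sq(9) by (auto simp: tile_edges_def)
  then have eE: "{u, v} \<in> graph_edges k G" using k sq(1) by (auto simp: graph_edges_def)
  then have uv: "u \<in> graph_vertices k G" "v \<in> graph_vertices k G"
    unfolding graph_vertices_def by auto
  have fresh: "x \<notin> graph_edges k G" if "u' \<in> x \<or> v' \<in> x" for x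
    using that sq(4,5) unfolding graph_vertices_def by auto
  have uniq: "e \<in> tile_edges (G j) \<longleftrightarrow> j = k" if "j \<in> {1..k}" for j
    using that ek sq(10)[of j] by (cases "j = k") auto
  show ?thesis
  proof (rule that[of "{u, u'}" "{v, v'}" "{u', v'}"])
    show "tile_edges (G (Suc k)) = {e, {u, u'}, {v, v'}, {u', v'}}" using sq(1,6) by simp
    show "{u, u'} \<noteq> {v, v'}" "{u, u'} \<noteq> {u', v'}" "{v, v'} \<noteq> {u', v'}"
      using sq(2-5) uv by (auto simp: doubleton_eq_iff)
    show "{u, u'} \<notin> graph_edges k G" "{v, v'} \<notin> graph_edges k G" "{u', v'} \<notin> graph_edges k G"
      using fresh by simp_all
    have "graph_edges (Suc k) G = graph_edges k G \<union> {{u, u'}, {v, v'}, {u', v'}}"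
      using eE unfolding graph_edges_Suc sq(6) by auto
    then show "matchings (graph_edges (Suc k) G) = insert {u', v'} ` matchings (graph_edges k G) \<union>
      (\<lambda>P. P - {e} \<union> {{u, u'}, {v, v'}}) ` {P \<in> matchings (graph_edges k G). e \<in> P}"
      using matchings_glue_square[OF eE sq(2,3)] sq(4,5) unfolding graph_vertices_def sq(1) by simp
    fix J assume J: "J \<subseteq> {1..k}"
    show "union_boundary G (insert (Suc k) J) =
       sym_diff (union_boundary G J) {e, {u, u'}, {v, v'}, {u', v'}}"
    proof (subst union_boundary_insert)
      show "Suc k \<notin> J" using J by auto
      show "i = j" if x: "x \<in> tile_edges (G (Suc k))" and ij: "i \<in> J" "j \<in> J"
        and xi: "x \<in> tile_edges (G i)" and xj: "x \<in> tile_edges (G j)" for x i j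
      proof -
        have "x \<in> graph_edges k G" using ij(1) xi J by (auto simp: graph_edges_def)
        then have "x = e" using x fresh unfolding sq(1,6) by blast
        moreover have "i \<in> {1..k}" "j \<in> {1..k}" using ij J by auto
        ultimately show ?thesis using uniq xi xj by metis
      qed
    qed (simp add: sq(1,6))
    show "e \<in> union_boundary G J \<longleftrightarrow> k \<in> J"
      using J uniq unfolding union_boundary_def by blast
  qed (use sq(7-10) ek in blast)+
qed

text \<open>
  The set of enclosed tiles is therefore determined by its boundary: the far edge of the last tile
  tells whether that tile belongs to the set.
\<close>

lemma inj_on_union_boundary:
  assumes G: "snake_graph d G"
  shows "inj_on (union_boundary G) (Pow {1..d})"
proof -
  have "inj_on (union_boundary G) (Pow {1..k})" if "1 \<le> k" "k \<le> d" for k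
    using that
  proof (induction k rule: dec_induct)
    case base
    have "J = {} \<or> J = {1}" if "J \<in> Pow {1..1}" for J :: "nat set" using that by auto
    then show ?case
      by (intro inj_onI) (metis union_boundary_empty union_boundary_singleton tile_edges_def insert_not_empty)
  next
    case (step k)
    then have k: "1 \<le> k" "k < d" by auto
    obtain e a b c where T: "c \<notin> graph_edges k G" and
      bd: "\<And>J. J \<subseteq> {1..k} \<Longrightarrow> union_boundary G (insert (Suc k) J) =
       sym_diff (union_boundary G J) {e, a, b, c}"
      by (rule snake_tile[OF G k refl]) blast
    have c: "c \<in> union_boundary G J \<longleftrightarrow> Suc k \<in> J" if J: "J \<subseteq> {1..Suc k}" for J
    proof (cases "Suc k \<in> J")
      case True
      have J': "J - {Suc k} \<subseteq> {1..k}" using J by (auto simp: subset_iff le_Suc_eq)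
      then have "c \<notin> union_boundary G (J - {Suc k})" using T union_boundary_subset by blast
      then show ?thesis using bd[OF J'] True by (simp add: insert_absorb)
    next
      case False
      then have "J \<subseteq> {1..k}" using J by (auto simp: subset_iff le_Suc_eq)
      then show ?thesis using union_boundary_subset T False by blast
    qed
    show ?case
    proof (rule inj_onI)
      fix J K assume JK: "J \<in> Pow {1..Suc k}" "K \<in> Pow {1..Suc k}"
        and eq: "union_boundary G J = union_boundary G K"
      have J': "J - {Suc k} \<subseteq> {1..k}" "K - {Suc k} \<subseteq> {1..k}"
        using JK by (auto simp: subset_iff le_Suc_eq)
      have mem: "Suc k \<in> J \<longleftrightarrow> Suc k \<in> K" using c[of J] c[of K] JK eq by auto
      have "union_boundary G (J - {Suc k}) = union_boundary G (K - {Suc k})"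
      proof (cases "Suc k \<in> J")
        case True
        then show ?thesis
          using bd[OF J'(1)] bd[OF J'(2)] eq mem by (simp add: insert_absorb) blast
      qed (use eq mem in simp)
      then have "J - {Suc k} = K - {Suc k}"
        using inj_onD[OF step.IH] J' k by auto
      then show "J = K" using mem by blast
    qed
  qed
  from this[of d] G show ?thesis by (simp add: snake_graph_def)
qed

section \<open>The perfect matchings of a snake graph\<close>

text \<open>A single tile is a square glued to its south edge.\<close>

lemma matchings_tile: "matchings (tile_edges t) = {{south t, north t}, {west t, east t}}"
proof -
  obtain x y where t: "t = (x, y)" by fastforce
  have one: "matchings {south t} = {{south t}}"
    by (auto simp: matchings_def south_def)
  have "tile_edges t = {south t} \<union> {west t, east t, north t}"
    by (auto simp: tile_edges_def)
  then have "matchings (tile_edges t) =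
      insert (north t) ` matchings {south t} \<union>
      (\<lambda>P. P - {south t} \<union> {west t, east t}) ` {P \<in> matchings {south t}. south t \<in> P}"
    using matchings_glue_square[of "(x, y)" "(x + 1, y)" "{south t}" "(x, y + 1)" "(x + 1, y + 1)"]
    by (simp add: t south_def north_def west_def east_def)
  then show ?thesis
    unfolding one by (auto simp: insert_commute)
qed

lemma fence_sets_1: "s 0 \<Longrightarrow> fence_sets s (Suc 0) = {{}, {Suc 0}}"
  by (auto simp: fence_sets_Suc fence_sets_0)

text \<open>
  How the two operations of \<open>matchings_glue_square\<close> act on a matching that is written as the symmetric
  difference of a reference matching \<open>M\<close> and a boundary \<open>B\<close>. The reference matching of the larger
  graph must avoid the gluing edge \<open>e\<close>, which forces the choice of the operation on \<open>M\<close>.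
\<close>

lemma sym_diff_square:
  assumes T: "T = {e, a, b, c}" and new: "a \<notin> M \<union> B" "b \<notin> M \<union> B" "c \<notin> M \<union> B"
    and neq: "a \<noteq> e" "b \<noteq> e" "c \<noteq> e" "a \<noteq> c" "b \<noteq> c"
  shows "e \<in> M \<Longrightarrow> e \<notin> B \<Longrightarrow> sym_diff (M - {e} \<union> {a, b}) B = sym_diff M B - {e} \<union> {a, b}"
    and "e \<in> M \<Longrightarrow> sym_diff (M - {e} \<union> {a, b}) (sym_diff B T) = insert c (sym_diff M B)"
    and "sym_diff (insert c M) B = insert c (sym_diff M B)"
    and "e \<notin> M \<Longrightarrow> e \<in> B \<Longrightarrow> sym_diff (insert c M) (sym_diff B T) = sym_diff M B - {e} \<union> {a, b}"
  using new neq unfolding T by auto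

text \<open>
  By induction on the number \<open>k\<close> of tiles; \<open>M\<close> is the minimal matching of the first \<open>k\<close> tiles, the
  only boundary matching with the west edge of the first tile. An exit of the last tile belongs to
  \<open>M\<close> exactly if its sign is \<open>-\<close>. So the sign of the edge \<open>e\<^sub>k\<close> decides how \<open>M\<close> extends, and since
  \<open>e\<^sub>k\<close> lies in the matching that encloses the tiles in \<open>J\<close> iff exactly one of \<open>e\<^sub>k \<in> M\<close> and \<open>k \<in> J\<close>
  holds, it also decides in which direction \<open>k\<close> and \<open>k + 1\<close> are related in the fence.
\<close>

lemma snake_matchings:
  assumes G: "snake_graph d G" and f: "sign_function d G f" and f0: "f (south (G 1)) = Minus"
    and s: "s = (\<lambda>k. f (snake_edge d G ed k) = Minus)" and k: "1 \<le> k" "k \<le> d"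
  obtains M where "M \<subseteq> graph_edges k G"
    "\<And>P. boundary_matching k G P \<Longrightarrow> west (G 1) \<in> P \<Longrightarrow> P = M"
    "\<And>x. x \<in> {north (G k), east (G k)} \<Longrightarrow> x \<in> M \<longleftrightarrow> f x = Minus"
    "matchings (graph_edges k G) = (\<lambda>J. sym_diff M (union_boundary G J)) ` fence_sets s k"
proof -
  let ?Q = "\<lambda>k M. M \<subseteq> graph_edges k G \<and>
    (\<forall>P. boundary_matching k G P \<and> west (G 1) \<in> P \<longrightarrow> P = M) \<and>
    (\<forall>x \<in> {north (G k), east (G k)}. x \<in> M \<longleftrightarrow> f x = Minus) \<and>
    matchings (graph_edges k G) = (\<lambda>J. sym_diff M (union_boundary G J)) ` fence_sets s k"
  have "\<exists>M. ?Q k M"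
    using k
  proof (induction k rule: dec_induct)
    case base
    let ?t = "G 1"
    have E: "graph_edges 1 G = tile_edges ?t" by (simp add: graph_edges_def)
    have dist: "west ?t \<noteq> south ?t" "west ?t \<noteq> north ?t" "east ?t \<noteq> south ?t" "east ?t \<noteq> north ?t"
      by (cases ?t; auto simp: north_def south_def west_def east_def doubleton_eq_iff)+
    have "1 \<in> {1..d}" using base by simp
    with f have sgn: "f (north ?t) = f (west ?t)" "f (south ?t) = f (east ?t)"
      "f (north ?t) \<noteq> f (south ?t)"
      unfolding sign_function_def by blast+
    have s0: "s 0" using f0 by (simp add: s snake_edge_def)
    have "sym_diff {west ?t, east ?t} (tile_edges ?t) = {south ?t, north ?t}"
      using dist by (auto simp: tile_edges_def)
    moreover have fs: "fence_sets s 1 = {{}, {1}}" using fence_sets_1[of s] s0 by simp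
    ultimately have flip: "(\<lambda>J. sym_diff {west ?t, east ?t} (union_boundary G J)) ` {{}, {1}} =
        {{west ?t, east ?t}, {south ?t, north ?t}}"
      by (simp add: union_boundary_empty union_boundary_singleton)
    show ?case
    proof (intro exI[of _ "{west ?t, east ?t}"] conjI allI impI ballI)
      show "{west ?t, east ?t} \<subseteq> graph_edges 1 G"
        unfolding E tile_edges_def by blast
      show "matchings (graph_edges 1 G) =
          (\<lambda>J. sym_diff {west ?t, east ?t} (union_boundary G J)) ` fence_sets s 1"
        unfolding E matchings_tile fs flip by (rule insert_commute)
    next
      fix P assume P: "boundary_matching 1 G P \<and> west ?t \<in> P"
      then have "P \<in> {{south ?t, north ?t}, {west ?t, east ?t}}"
        unfolding boundary_matching_def perfect_matching_iff E matchings_tile by blast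
      then show "P = {west ?t, east ?t}" using P dist(1,2) by blast
    next
      fix x assume x: "x \<in> {north ?t, east ?t}"
      show "x \<in> {west ?t, east ?t} \<longleftrightarrow> f x = Minus"
      proof (cases "x = east ?t")
        case True
        then show ?thesis using sgn(2) f0 by simp
      next
        case False
        then have "x = north ?t" using x by blast
        moreover have "f (north ?t) \<noteq> Minus" using sgn(3) f0 by metis
        ultimately show ?thesis using dist(2,4) by blast
      qed
    qed
  next
    case (step k)
    then have k: "1 \<le> k" "k < d" by auto
    obtain M where Q: "?Q k M"
      using step.IH[OF less_imp_le[OF k(2)]] by (rule exE)
    note M = conjunct1[OF Q] conjunct2[OF conjunct2[OF conjunct2[OF Q]]]
    have M_unique: "P = M" if "boundary_matching k G P" "west (G 1) \<in> P" for P
      using conjunct1[OF conjunct2[OF Q]] that by simp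
    have M_exits: "x \<in> M \<longleftrightarrow> f x = Minus" if "x \<in> {north (G k), east (G k)}" for x
      using conjunct1[OF conjunct2[OF conjunct2[OF Q]]] that by (rule bspec)
    define e where "e = snake_edge d G ed k"
    obtain a b c where T: "tile_edges (G (Suc k)) = {e, a, b, c}" "a \<noteq> b" "a \<noteq> c" "b \<noteq> c"
      and fresh: "a \<notin> graph_edges k G" "b \<notin> graph_edges k G" "c \<notin> graph_edges k G"
      and e: "e \<in> tile_edges (G k)" "e \<in> {north (G k), east (G k)}"
      and new: "{north (G (Suc k)), east (G (Suc k))} = {b, c}"
      and sgn': "\<And>f. sign_function d G f \<Longrightarrow> f b = f e \<and> f c \<noteq> f e"
      and mat: "matchings (graph_edges (Suc k) G) = insert c ` matchings (graph_edges k G) \<union>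
        (\<lambda>P. P - {e} \<union> {a, b}) ` {P \<in> matchings (graph_edges k G). e \<in> P}"
      and bd: "\<And>J. J \<subseteq> {1..k} \<Longrightarrow> union_boundary G (insert (Suc k) J) =
         sym_diff (union_boundary G J) {e, a, b, c}"
      and bde: "\<And>J. J \<subseteq> {1..k} \<Longrightarrow> e \<in> union_boundary G J \<longleftrightarrow> k \<in> J"
      by (rule snake_tile[OF G k e_def], rule that)
    have sgn: "f b = f e" "f c \<noteq> f e" using sgn'[OF f] by auto
    let ?F = "fence_sets s k"
    let ?E = "graph_edges k G"
    let ?\<Phi> = "\<lambda>M J. sym_diff M (union_boundary G J)"
    let ?swap = "\<lambda>P. P - {e} \<union> {a, b}"
    have eE: "e \<in> ?E" using e(1) k by (auto simp: graph_edges_def)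
    then have ne: "a \<noteq> e" "b \<noteq> e" "c \<noteq> e" using fresh by auto
    have w: "west (G 1) \<in> ?E" using k by (auto simp: graph_edges_def tile_edges_def)
    have se: "s k \<longleftrightarrow> e \<in> M" using M_exits[OF e(2)] by (simp add: s e_def)
    have Fsub: "J \<subseteq> {1..k}" if "J \<in> ?F" for J using that by (rule fence_sets_subset)
    have Bsub: "union_boundary G J \<subseteq> ?E" if "J \<in> ?F" for J
      using Fsub[OF that] by (rule union_boundary_subset)
    have sq: "e \<in> M \<Longrightarrow> k \<notin> J \<Longrightarrow> ?\<Phi> (?swap M) J = ?swap (?\<Phi> M J)"
      "e \<in> M \<Longrightarrow> ?\<Phi> (?swap M) (insert (Suc k) J) = insert c (?\<Phi> M J)"
      "?\<Phi> (insert c M) J = insert c (?\<Phi> M J)"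
      "e \<notin> M \<Longrightarrow> k \<in> J \<Longrightarrow> ?\<Phi> (insert c M) (insert (Suc k) J) = ?swap (?\<Phi> M J)"
      "e \<in> ?\<Phi> M J \<longleftrightarrow> (e \<in> M \<longleftrightarrow> k \<notin> J)"
      if J: "J \<in> ?F" for J
    proof -
      have "a \<notin> M \<union> union_boundary G J" "b \<notin> M \<union> union_boundary G J" "c \<notin> M \<union> union_boundary G J"
        using fresh M(1) Bsub[OF J] by auto
      note sq = sym_diff_square[OF refl this ne T(3,4)]
      note B = bd[OF Fsub[OF J]] and m = bde[OF Fsub[OF J]]
      show "e \<in> M \<Longrightarrow> k \<notin> J \<Longrightarrow> ?\<Phi> (?swap M) J = ?swap (?\<Phi> M J)"
        using m by (intro sq(1)) simp_all
      show "e \<in> M \<Longrightarrow> ?\<Phi> (?swap M) (insert (Suc k) J) = insert c (?\<Phi> M J)"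
        unfolding B by (rule sq(2))
      show "?\<Phi> (insert c M) J = insert c (?\<Phi> M J)"
        by (rule sq(3))
      show "e \<notin> M \<Longrightarrow> k \<in> J \<Longrightarrow> ?\<Phi> (insert c M) (insert (Suc k) J) = ?swap (?\<Phi> M J)"
        unfolding B using m by (intro sq(4)) simp_all
      show "e \<in> ?\<Phi> M J \<longleftrightarrow> (e \<in> M \<longleftrightarrow> k \<notin> J)"
        using m by auto
    qed
    define M' where "M' = (if s k then ?swap M else insert c M)"
    have sub: "M' \<subseteq> graph_edges (Suc k) G"
      using M(1) unfolding M'_def graph_edges_Suc T(1) by auto
    have exits: "x \<in> M' \<longleftrightarrow> f x = Minus" if "x \<in> {north (G (Suc k)), east (G (Suc k))}" for x
    proof -
      have fb: "f b = Minus \<longleftrightarrow> s k" using sgn(1) by (simp add: s e_def)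
      have fc: "f c = Minus \<longleftrightarrow> \<not> s k" using sgn(2) by (cases "f c"; cases "f e") (simp_all add: s e_def)
      have no: "b \<notin> M" "c \<notin> M" using fresh M(1) by auto
      have "b \<in> M' \<longleftrightarrow> s k" "c \<in> M' \<longleftrightarrow> \<not> s k"
        unfolding M'_def using no T(3,4) by simp_all
      moreover have "x = b \<or> x = c" using that[unfolded new] by simp
      ultimately show ?thesis using fb fc by blast
    qed
    have flips: "matchings (graph_edges (Suc k) G) = ?\<Phi> M' ` fence_sets s (Suc k)"
    proof -
      have sel: "{P \<in> matchings ?E. e \<in> P} = ?\<Phi> M ` {J \<in> ?F. e \<in> M \<longleftrightarrow> k \<notin> J}"
        unfolding M(2) Compr_image_eq
        by (rule arg_cong[of _ _ "image _"], rule Collect_cong, rule conj_cong[OF refl], rule sq(5))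
      have m: "matchings (graph_edges (Suc k) G) = (\<lambda>J. insert c (?\<Phi> M J)) ` ?F \<union>
          (\<lambda>J. ?swap (?\<Phi> M J)) ` {J \<in> ?F. e \<in> M \<longleftrightarrow> k \<notin> J}"
        unfolding mat sel unfolding M(2) image_image ..
      show ?thesis
      proof (cases "s k")
        case True
        have "?\<Phi> M' ` fence_sets s (Suc k) =
            ?\<Phi> M' ` {J \<in> ?F. k \<notin> J} \<union> (\<lambda>J. ?\<Phi> M' (insert (Suc k) J)) ` ?F"
          using True by (simp only: fence_sets_Suc if_True image_Un image_image)
        also have "?\<Phi> M' ` {J \<in> ?F. k \<notin> J} = (\<lambda>J. ?swap (?\<Phi> M J)) ` {J \<in> ?F. k \<notin> J}"
          unfolding M'_def if_P[OF True]
          by (rule image_cong[OF refl], rule sq(1)) (simp_all add: True flip: se)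
        also have "(\<lambda>J. ?\<Phi> M' (insert (Suc k) J)) ` ?F = (\<lambda>J. insert c (?\<Phi> M J)) ` ?F"
          unfolding M'_def if_P[OF True]
          by (rule image_cong[OF refl], rule sq(2)) (simp_all add: True flip: se)
        finally show ?thesis unfolding m using True se by (simp add: Un_commute)
      next
        case False
        have "?\<Phi> M' ` fence_sets s (Suc k) =
            ?\<Phi> M' ` ?F \<union> (\<lambda>J. ?\<Phi> M' (insert (Suc k) J)) ` {J \<in> ?F. k \<in> J}"
          using False by (simp only: fence_sets_Suc if_False image_Un image_image)
        also have "?\<Phi> M' ` ?F = (\<lambda>J. insert c (?\<Phi> M J)) ` ?F"
          unfolding M'_def if_not_P[OF False]
          by (rule image_cong[OF refl], rule sq(3))
        also have "(\<lambda>J. ?\<Phi> M' (insert (Suc k) J)) ` {J \<in> ?F. k \<in> J} =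
            (\<lambda>J. ?swap (?\<Phi> M J)) ` {J \<in> ?F. k \<in> J}"
          unfolding M'_def if_not_P[OF False]
          by (rule image_cong[OF refl], rule sq(4)) (simp_all add: False flip: se)
        finally show ?thesis unfolding m using False se by simp
      qed
    qed
    have unique: "P = M'" if P: "boundary_matching (Suc k) G P" and wP: "west (G 1) \<in> P" for P
    proof -
      have once: "\<exists>!j. j \<in> {1..Suc k} \<and> x \<in> tile_edges (G j)" if "x \<in> P" for x
        using P that by (auto simp: boundary_matching_def union_boundary_def)
      have eP: "e \<notin> P"
      proof
        assume "e \<in> P"
        from once[OF this] obtain i where i: "\<And>j. j \<in> {1..Suc k} \<Longrightarrow> e \<in> tile_edges (G j) \<Longrightarrow> j = i"
          by blast
        have "k = i" using k e(1) by (intro i) simp_all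
        moreover have "Suc k = i" using T(1) by (intro i) simp_all
        ultimately show False by simp
      qed
      have old: "x \<in> union_boundary G {1..k}" if x: "x \<in> P" "x \<in> ?E" for x
      proof -
        obtain j where j: "j \<in> {1..k}" "x \<in> tile_edges (G j)"
          using x(2) by (auto simp: graph_edges_def)
        obtain i where i: "\<And>j. j \<in> {1..Suc k} \<Longrightarrow> x \<in> tile_edges (G j) \<Longrightarrow> j = i"
          using once[OF x(1)] by blast
        have "l = j" if "l \<in> {1..k} \<and> x \<in> tile_edges (G l)" for l
          using i[of l] i[of j] that j by simp
        then show ?thesis unfolding union_boundary_def using j by blast
      qed
      \<comment> \<open>\<open>e\<close> is a boundary edge of the first \<open>k\<close> tiles, though not of the first \<open>k + 1\<close>\<close>
      have minimal: "R = M" if "R \<in> matchings ?E" "R \<subseteq> insert e P" "west (G 1) \<in> R" for R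
      proof (rule M_unique)
        have "e \<in> union_boundary G {1..k}" using bde[of "{1..k}"] k by simp
        then show "boundary_matching k G R"
          using that(1,2) matchingsD(1)[OF that(1)] old
          unfolding boundary_matching_def perfect_matching_iff by blast
      qed (fact that)
      have "P \<in> matchings (graph_edges (Suc k) G)"
        using P by (simp add: boundary_matching_def perfect_matching_iff)
      then consider R where "R \<in> matchings ?E" "P = insert c R"
        | R where "R \<in> matchings ?E" "e \<in> R" "P = ?swap R"
        unfolding mat by blast
      then show ?thesis
      proof cases
        case 1
        then have "R = M" using wP w fresh by (intro minimal) auto
        then show ?thesis using 1 eP se by (simp add: M'_def)
      next
        case 2
        have "west (G 1) \<in> R" using 2(3) wP w fresh by auto
        then have "R = M" using 2 by (intro minimal) auto
        then show ?thesis using 2 se by (simp add: M'_def)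
      qed
    qed
    show ?case
    proof (intro exI[of _ M'] conjI allI impI ballI)
      show "M' \<subseteq> graph_edges (Suc k) G" by (rule sub)
      show "P = M'" if "boundary_matching (Suc k) G P \<and> west (G 1) \<in> P" for P
        using that by (intro unique) simp_all
      show "x \<in> M' \<longleftrightarrow> f x = Minus" if "x \<in> {north (G (Suc k)), east (G (Suc k))}" for x
        using that by (rule exits)
      show "matchings (graph_edges (Suc k) G) = ?\<Phi> M' ` fence_sets s (Suc k)" by (rule flips)
    qed
  qed
  then obtain M where Q: "?Q k M" by (rule exE)
  show ?thesis
  proof (rule that)
    show "M \<subseteq> graph_edges k G" by (rule conjunct1[OF Q])
    show "P = M" if "boundary_matching k G P" "west (G 1) \<in> P" for P
      using conjunct1[OF conjunct2[OF Q]] that by simp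
    show "x \<in> M \<longleftrightarrow> f x = Minus" if "x \<in> {north (G k), east (G k)}" for x
      using conjunct1[OF conjunct2[OF conjunct2[OF Q]]] that by (rule bspec)
    show "matchings (graph_edges k G) = (\<lambda>J. sym_diff M (union_boundary G J)) ` fence_sets s k"
      by (rule conjunct2[OF conjunct2[OF conjunct2[OF Q]]])
  qed
qed

lemma F_polynomial_eq_fence_sum:
  assumes G: "snake_graph d G" and f: "sign_function d G f" and f0: "f (south (G 1)) = Minus"
    and Pm: "boundary_matching d G Pm" "west (G 1) \<in> Pm"
  shows "F_polynomial d G \<tau> Pm =
    fence_sum (\<lambda>k. f (snake_edge d G ed k) = Minus) (\<lambda>j. yvar (\<tau> j)) d"
proof -
  define s where "s = (\<lambda>k. f (snake_edge d G ed k) = Minus)"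
  have d: "1 \<le> d" using G by (simp add: snake_graph_def)
  obtain M where M: "\<And>P. boundary_matching d G P \<Longrightarrow> west (G 1) \<in> P \<Longrightarrow> P = M"
    "matchings (graph_edges d G) = (\<lambda>J. sym_diff M (union_boundary G J)) ` fence_sets s d"
    by (rule snake_matchings[OF G f f0 s_def d order_refl]) blast
  have mat: "{P. perfect_matching d G P} = (\<lambda>J. sym_diff Pm (union_boundary G J)) ` fence_sets s d"
    using M(2) M(1)[OF Pm] by (simp add: perfect_matching_iff)
  have sub: "J \<subseteq> {1..d}" if "J \<in> fence_sets s d" for J
    using that by (rule fence_sets_subset)
  have enc: "enclosed_tiles d G Pm (sym_diff Pm (union_boundary G J)) = J" if "J \<in> fence_sets s d" for J
    unfolding enclosed_tiles_def
  proof (rule the_equality)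
    have "sym_diff (sym_diff Pm (union_boundary G J)) Pm = union_boundary G J" by blast
    then show *: "J \<subseteq> {1..d} \<and> sym_diff (sym_diff Pm (union_boundary G J)) Pm = union_boundary G J"
      using sub[OF that] by blast
    show "K = J" if "K \<subseteq> {1..d} \<and> sym_diff (sym_diff Pm (union_boundary G J)) Pm = union_boundary G K" for K
      using that * inj_onD[OF inj_on_union_boundary[OF G], of K J] by auto
  qed
  have "inj_on (\<lambda>J. sym_diff Pm (union_boundary G J)) (fence_sets s d)"
    by (rule inj_on_inverseI[of _ "enclosed_tiles d G Pm"]) (rule enc)
  then show ?thesis
    unfolding F_polynomial_def mat fence_sum_def s_def[symmetric]
    by (simp add: sum.reindex height_monomial_def enc)
qed

section \<open>The \<open>F\<close>-polynomial of a continued fraction\<close>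

theorem theorem3p6:
  fixes n :: nat and a :: "nat \<Rightarrow> nat" and G :: "nat \<Rightarrow> tile" and \<tau> :: "nat \<Rightarrow> 'l"
    and Pm :: "edge set"
  assumes "positive_cf n a" and "a 1 > 1"
    and "cf_snake_graph n a G"
    and "boundary_matching (ell a n - 1) G Pm"
    and "west (G 1) \<in> Pm"
  shows "F_polynomial (ell a n - 1) G \<tau> Pm =
    (if odd n then unit_inv (C_mon a \<tau> n) * cf_numerator (calL a \<tau>) n
     else cf_numerator (calL a \<tau>) n)"
proof -
  define d where "d = ell a n - 1"
  obtain f ed where G: "snake_graph d G" and f: "sign_function d G f"
    and sgn: "\<And>i m. i \<in> {1..n} \<Longrightarrow> m \<in> {ell a (i - 1)..<ell a i} \<Longrightarrow>
      f (snake_edge d G ed m) = (if odd i then Minus else Plus)"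
    using assms(3) unfolding cf_snake_graph_def d_def Let_def by blast
  define s where "s = (\<lambda>k. f (snake_edge d G ed k) = Minus)"
  have n: "1 \<le> n" using assms(1) by (simp add: positive_cf_def)
  have f0: "f (south (G 1)) = Minus"
    using sgn[of 1 0] n assms(2) by (simp add: ell_def snake_edge_def)
  have "s m \<longleftrightarrow> odd i" if "1 \<le> i" "i \<le> n" "ell a (i - 1) \<le> m" "m < ell a i" for i m
    using sgn[of i m] that by (simp add: s_def)
  then have "fence_sum s (\<lambda>j. yvar (\<tau> j)) d = cf_F a \<tau> n"
    using fence_sum_blocks[OF assms(1), of s n] n unfolding d_def by blast
  then show ?thesis
    using F_polynomial_eq_fence_sum[OF G f f0, of Pm \<tau> ed] assms(4,5)
    unfolding s_def d_def cf_F_def by simp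
qed

end
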